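(* Let $p$ be prime, $m\ge1$, $n=2m+1$. Let $\Gamma$ be a profinite group and $\gamma\colon\Gamma\to\tilde G$ a continuous homomorphism. Let $\Lambda=\gamma^{-1}(\tilde N)$ and $\lambda\colon\Lambda\to\tilde N$ the restriction of $\gamma$. Then the following are equivalent: (1) there is a continuous homomorphism $\tilde\gamma\colon\Gamma\to\tilde{\mathbb U}_n$ with $q\circ\tilde\gamma=\gamma$, where $q\colon\tilde{\mathbb U}_n\to\tilde G$, $(u,g)\mapsto g$; (2) for every $x\in H^1(\tilde N_1,\mathbb F_p)$ and every $y\in H^1(\tilde N_2',\mathbb F_p)$, both viewed in $H^1(\tilde N,\mathbb F_p)$ via the projections of $\tilde N=\tilde N_1\times\tilde N_2'$ onto its factors, we have $\lambda^*(x)\smile\lambda^*(y)=0$ in $H^2(\Lambda,\mathbb F_p)$.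
   Context: $\mathbb U_m$ is the group of upper unitriangular $m\times m$ matrices over $\mathbb F_p$; $R=\mathbb F_p[\mathbb U_m]$ its group algebra, with $\mathbb U_m$ acting by left multiplication; $W=R\rtimes\mathbb U_m$ with product $(x,h)(x',h')=(x+hx',hh')$. $\tilde G=W\times W$. $M=R\otimes_{\mathbb F_p}R$, with $g=((x_1,h_1),(x_2,h_2))\in\tilde G$ acting by $g\cdot(r\otimes r')=h_1r\otimes h_2r'$. $\tilde{\mathbb U}_n$ is the set $M\times\tilde G$ with product $(u,g)(u',g')=(u+g\cdot u'+x_1\otimes h_2x_2',\,gg')$ for $g=((x_1,h_1),(x_2,h_2))$, $g'=((x_1',h_1'),(x_2',h_2'))$; this is the extension of $\tilde G$ by $M$ classified by the cup product of the 1-cocycles $g\mapsto x_1\in R$ and $g\mapsto x_2\in R$. $\tilde N_1=\{(x,1):x\in R\}\subset W$ (first factor), $\tilde N_2'=\{(x,1):x\in R\}\subset W$ (second factor), $\tilde N=\tilde N_1\times\tilde N_2'\subset\tilde G$; these are elementary abelian. *)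

theory Defs
  imports
    "HOL-Algebra.Coset"
    "HOL-Analysis.T1_Spaces"
    "Jordan_Normal_Form.Matrix"
    "Berlekamp_Zassenhaus.Finite_Field"
begin

text \<open>The field with \<open>p\<close> elements is the type \<open>'p mod_ring\<close>, where \<open>'p\<close> ranges over the types whose
  cardinality is a prime \<open>p\<close> (class \<open>prime_card\<close>). The constructions below are written over an
  arbitrary field or commutative ring \<open>'k\<close>.\<close>

section \<open>Profinite groups\<close>

definition topological_group :: "('a, 'b) monoid_scheme \<Rightarrow> 'a topology \<Rightarrow> bool" where
  "topological_group G T \<longleftrightarrow>
     group G \<and> topspace T = carrier G \<and>
     continuous_map (prod_topology T T) T (\<lambda>(a, b). a \<otimes>\<^bsub>G\<^esub> b) \<and>
     continuous_map T T (\<lambda>a. inv\<^bsub>G\<^esub> a)"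

definition totally_disconnected_space :: "'a topology \<Rightarrow> bool" where
  "totally_disconnected_space T \<longleftrightarrow> (\<forall>S. connectedin T S \<longrightarrow> (\<exists>a. S \<subseteq> {a}))"

definition profinite_group :: "('a, 'b) monoid_scheme \<Rightarrow> 'a topology \<Rightarrow> bool" where
  "profinite_group G T \<longleftrightarrow>
     topological_group G T \<and> compact_space T \<and> Hausdorff_space T \<and> totally_disconnected_space T"

section \<open>Continuous cohomology in degrees 1 and 2 with trivial coefficients\<close>

text \<open>Cohomology is computed by continuous inhomogeneous cochains with values in \<open>'k\<close>, which is
  discrete and carries the trivial action. To make a cochain determined by its values on the group,
  it is required to vanish off the carrier.\<close>

definition zero_extend :: "'a set \<Rightarrow> ('a \<Rightarrow> 'k::zero) \<Rightarrow> 'a \<Rightarrow> 'k" where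
  "zero_extend S f = (\<lambda>a. if a \<in> S then f a else 0)"

definition cochain_group :: "'a topology \<Rightarrow> ('a \<Rightarrow> 'k::comm_ring_1) monoid" where
  "cochain_group X =
     \<lparr>carrier = {f. continuous_map X (discrete_topology UNIV) f \<and> (\<forall>a. a \<notin> topspace X \<longrightarrow> f a = 0)},
      mult = (\<lambda>f g a. f a + g a), one = (\<lambda>_. 0)\<rparr>"

abbreviation C1 :: "'a topology \<Rightarrow> ('a \<Rightarrow> 'k::comm_ring_1) monoid" where
  "C1 T \<equiv> cochain_group T"

abbreviation C2 :: "'a topology \<Rightarrow> ('a \<times> 'a \<Rightarrow> 'k::comm_ring_1) monoid" where
  "C2 T \<equiv> cochain_group (prod_topology T T)"

definition d1 :: "('a, 'b) monoid_scheme \<Rightarrow> ('a \<Rightarrow> 'k::comm_ring_1) \<Rightarrow> 'a \<times> 'a \<Rightarrow> 'k" where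
  "d1 G f = zero_extend (carrier G \<times> carrier G) (\<lambda>(a, b). f b - f (a \<otimes>\<^bsub>G\<^esub> b) + f a)"

definition d2 :: "('a, 'b) monoid_scheme \<Rightarrow> ('a \<times> 'a \<Rightarrow> 'k::comm_ring_1) \<Rightarrow> 'a \<times> 'a \<times> 'a \<Rightarrow> 'k" where
  "d2 G f = zero_extend (carrier G \<times> carrier G \<times> carrier G)
     (\<lambda>(a, b, c). f (b, c) - f (a \<otimes>\<^bsub>G\<^esub> b, c) + f (a, b \<otimes>\<^bsub>G\<^esub> c) - f (a, b))"

definition Z1 :: "('a, 'b) monoid_scheme \<Rightarrow> 'a topology \<Rightarrow> ('a \<Rightarrow> 'k::comm_ring_1) set" where
  "Z1 G T = {f \<in> carrier (C1 T). d1 G f = (\<lambda>_. 0)}"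

text \<open>The coboundary of a 0-cochain \<open>c\<close> is \<open>a \<mapsto> a \<cdot> c - c\<close>, which is 0 for the trivial action.\<close>

definition B1 :: "('a \<Rightarrow> 'k::comm_ring_1) set" where
  "B1 = {\<lambda>_. 0}"

definition Z2 :: "('a, 'b) monoid_scheme \<Rightarrow> 'a topology \<Rightarrow> ('a \<times> 'a \<Rightarrow> 'k::comm_ring_1) set" where
  "Z2 G T = {f \<in> carrier (C2 T). d2 G f = (\<lambda>_. 0)}"

definition B2 :: "('a, 'b) monoid_scheme \<Rightarrow> 'a topology \<Rightarrow> ('a \<times> 'a \<Rightarrow> 'k::comm_ring_1) set" where
  "B2 G T = d1 G ` carrier (C1 T)"

definition H1 :: "('a, 'b) monoid_scheme \<Rightarrow> 'a topology \<Rightarrow> ('a \<Rightarrow> 'k::comm_ring_1) set monoid" where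
  "H1 G T = (C1 T)\<lparr>carrier := Z1 G T\<rparr> Mod B1"

definition H2 :: "('a, 'b) monoid_scheme \<Rightarrow> 'a topology \<Rightarrow> ('a \<times> 'a \<Rightarrow> 'k::comm_ring_1) set monoid" where
  "H2 G T = (C2 T)\<lparr>carrier := Z2 G T\<rparr> Mod B2 G T"

text \<open>Classes are cosets. The operations on classes below are unions over all representatives of the
  coset of the resulting cocycle; all these cosets coincide, so the union is that coset.\<close>

definition pullback1 ::
  "('a, 'c) monoid_scheme \<Rightarrow> 'a topology \<Rightarrow> ('a \<Rightarrow> 'b) \<Rightarrow> ('b \<Rightarrow> 'k::comm_ring_1) set \<Rightarrow> ('a \<Rightarrow> 'k) set" where
  "pullback1 G T \<phi> X = (\<Union>f\<in>X. B1 #>\<^bsub>C1 T\<^esub> zero_extend (carrier G) (f \<circ> \<phi>))"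

definition cup11 ::
  "('a, 'c) monoid_scheme \<Rightarrow> 'a topology \<Rightarrow> ('a \<Rightarrow> 'k::comm_ring_1) set \<Rightarrow> ('a \<Rightarrow> 'k) set \<Rightarrow>
    ('a \<times> 'a \<Rightarrow> 'k) set" where
  "cup11 G T X Y = (\<Union>f\<in>X. \<Union>g\<in>Y. B2 G T #>\<^bsub>C2 T\<^esub> (\<lambda>(a, b). f a * g b))"

section \<open>Group algebras and their tensor products\<close>

text \<open>The element \<open>\<Sum> r\<^sub>a [a]\<close> of the group algebra is encoded by its coefficient function \<open>a \<mapsto> r\<^sub>a\<close>.\<close>

definition group_algebra :: "('a, 'b) monoid_scheme \<Rightarrow> ('a \<Rightarrow> 'k::field) set" where
  "group_algebra G = {r. finite {a. r a \<noteq> 0} \<and> {a. r a \<noteq> 0} \<subseteq> carrier G}"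

definition left_mult :: "('a, 'b) monoid_scheme \<Rightarrow> 'a \<Rightarrow> ('a \<Rightarrow> 'k::field) \<Rightarrow> 'a \<Rightarrow> 'k" where
  "left_mult G h r = zero_extend (carrier G) (\<lambda>a. r (inv\<^bsub>G\<^esub> h \<otimes>\<^bsub>G\<^esub> a))"

text \<open>The tensor product \<open>k[G] \<otimes> k[G]\<close> is modelled by coefficient functions with respect to the basis
  \<open>[a] \<otimes> [b]\<close>. The universal property is \<open>tensor_universal\<close> below.\<close>

definition tensor_space :: "('a, 'b) monoid_scheme \<Rightarrow> ('a \<times> 'a \<Rightarrow> 'k::field) set" where
  "tensor_space G = {u. finite {z. u z \<noteq> 0} \<and> {z. u z \<noteq> 0} \<subseteq> carrier G \<times> carrier G}"

definition tensor :: "('a \<Rightarrow> 'k::field) \<Rightarrow> ('a \<Rightarrow> 'k) \<Rightarrow> 'a \<times> 'a \<Rightarrow> 'k" where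
  "tensor r r' = (\<lambda>(a, b). r a * r' b)"

text \<open>The linear action with \<open>(h\<^sub>1, h\<^sub>2) \<cdot> (r \<otimes> r') = h\<^sub>1 r \<otimes> h\<^sub>2 r'\<close>; see \<open>tensor_act_tensor\<close>.\<close>

definition tensor_act ::
  "('a, 'b) monoid_scheme \<Rightarrow> 'a \<Rightarrow> 'a \<Rightarrow> ('a \<times> 'a \<Rightarrow> 'k::field) \<Rightarrow> 'a \<times> 'a \<Rightarrow> 'k" where
  "tensor_act G h\<^sub>1 h\<^sub>2 u = zero_extend (carrier G \<times> carrier G)
     (\<lambda>(a, b). u (inv\<^bsub>G\<^esub> h\<^sub>1 \<otimes>\<^bsub>G\<^esub> a, inv\<^bsub>G\<^esub> h\<^sub>2 \<otimes>\<^bsub>G\<^esub> b))"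

lemma tensor_act_tensor:
  "tensor_act G h\<^sub>1 h\<^sub>2 (tensor r r') = tensor (left_mult G h\<^sub>1 r) (left_mult G h\<^sub>2 r')"
  by (auto simp: tensor_act_def tensor_def left_mult_def zero_extend_def fun_eq_iff)

lemma tensor_act_add:
  "tensor_act G h\<^sub>1 h\<^sub>2 (\<lambda>z. u z + v z) = (\<lambda>z. tensor_act G h\<^sub>1 h\<^sub>2 u z + tensor_act G h\<^sub>1 h\<^sub>2 v z)"
  by (auto simp: tensor_act_def zero_extend_def fun_eq_iff)

lemma tensor_act_scale:
  "tensor_act G h\<^sub>1 h\<^sub>2 (\<lambda>z. c * u z) = (\<lambda>z. c * tensor_act G h\<^sub>1 h\<^sub>2 u z)"
  by (auto simp: tensor_act_def zero_extend_def fun_eq_iff)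

lemma tensor_in_tensor_space:
  assumes "r \<in> group_algebra G" "r' \<in> group_algebra G"
  shows "tensor r r' \<in> tensor_space G"
proof -
  have "{z. tensor r r' z \<noteq> 0} = {a. r a \<noteq> 0} \<times> {b. r' b \<noteq> 0}"
    by (auto simp: tensor_def)
  then show ?thesis
    using assms by (auto simp: tensor_space_def group_algebra_def)
qed

definition linear_on_space ::
  "('k::field \<Rightarrow> 'v::ab_group_add \<Rightarrow> 'v) \<Rightarrow> ('x \<Rightarrow> 'k) set \<Rightarrow> (('x \<Rightarrow> 'k) \<Rightarrow> 'v) \<Rightarrow> bool" where
  "linear_on_space sc S F \<longleftrightarrow>
     (\<forall>u\<in>S. \<forall>v\<in>S. F (\<lambda>z. u z + v z) = F u + F v) \<and>
     (\<forall>c. \<forall>u\<in>S. F (\<lambda>z. c * u z) = sc c (F u))"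

lemma linear_on_space_expand:
  fixes sc :: "'k::field \<Rightarrow> 'v::ab_group_add \<Rightarrow> 'v" and u :: "'x \<Rightarrow> 'k"
  assumes "vector_space sc"
    and lin: "linear_on_space sc {u. finite {z. u z \<noteq> 0} \<and> {z. u z \<noteq> 0} \<subseteq> A} F"
    and "finite {z. u z \<noteq> 0}" "{z. u z \<noteq> 0} \<subseteq> A"
  shows "F u = (\<Sum>z | u z \<noteq> 0. sc (u z) (F (\<lambda>w. if w = z then 1 else 0)))"
proof -
  interpret vector_space sc by fact
  let ?S = "{u::'x \<Rightarrow> 'k. finite {z. u z \<noteq> 0} \<and> {z. u z \<noteq> 0} \<subseteq> A}"
  let ?e = "\<lambda>z w. if w = z then 1 else (0::'k)"
  have add: "F (\<lambda>z. u z + v z) = F u + F v" if "u \<in> ?S" "v \<in> ?S" for u v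
    using lin that by (auto simp: linear_on_space_def)
  have scal: "F (\<lambda>z. c * u z) = sc c (F u)" if "u \<in> ?S" for c u
    using lin that by (auto simp: linear_on_space_def)
  have z0: "(\<lambda>_. 0) \<in> ?S" by simp
  have F0: "F (\<lambda>_. 0) = 0"
    using scal[OF z0, of 0] by simp
  have eS: "?e z \<in> ?S" if "z \<in> A" for z
    using that by (auto intro: finite_subset[of _ "{z}"])
  have main: "F (\<lambda>w. if w \<in> B then u w else 0) = (\<Sum>z\<in>B. sc (u z) (F (?e z)))"
    if "finite B" "B \<subseteq> A" for B
    using that
  proof (induction B rule: finite_induct)
    case empty
    then show ?case by (simp add: F0)
  next
    case (insert z B)
    have 1: "(\<lambda>w. u z * ?e z w) \<in> ?S"
      using insert by (auto intro: finite_subset[of _ "{z}"])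
    have 2: "(\<lambda>w. if w \<in> B then u w else 0) \<in> ?S"
      using insert by (auto intro: finite_subset[of _ B])
    have "(\<lambda>w. if w \<in> insert z B then u w else 0) =
        (\<lambda>w. u z * ?e z w + (if w \<in> B then u w else 0))"
      using insert by (auto simp: fun_eq_iff)
    then have "F (\<lambda>w. if w \<in> insert z B then u w else 0) =
        F (\<lambda>w. u z * ?e z w) + F (\<lambda>w. if w \<in> B then u w else 0)"
      using add[OF 1 2] by simp
    also have "\<dots> = sc (u z) (F (?e z)) + (\<Sum>z\<in>B. sc (u z) (F (?e z)))"
      using insert scal[OF eS, of z "u z"] by auto
    finally show ?case
      using insert by simp
  qed
  have "(\<lambda>w. if w \<in> {z. u z \<noteq> 0} then u w else 0) = u"
    by auto
  then show ?thesis
    using main[OF assms(3,4)] by simp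
qed

lemma tensor_universal:
  fixes sc :: "'k::field \<Rightarrow> 'v::ab_group_add \<Rightarrow> 'v" and \<beta> :: "('a \<Rightarrow> 'k) \<Rightarrow> ('a \<Rightarrow> 'k) \<Rightarrow> 'v"
  assumes vs: "vector_space sc"
    and l: "\<And>r'. r' \<in> group_algebra G \<Longrightarrow> linear_on_space sc (group_algebra G) (\<lambda>r. \<beta> r r')"
    and r: "\<And>r. r \<in> group_algebra G \<Longrightarrow> linear_on_space sc (group_algebra G) (\<beta> r)"
  shows "\<exists>F. linear_on_space sc (tensor_space G) F \<and>
      (\<forall>r\<in>group_algebra G. \<forall>r'\<in>group_algebra G. F (tensor r r') = \<beta> r r') \<and>
      (\<forall>F'. linear_on_space sc (tensor_space G) F' \<and>
         (\<forall>r\<in>group_algebra G. \<forall>r'\<in>group_algebra G. F' (tensor r r') = \<beta> r r') \<longrightarrow>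
         (\<forall>u\<in>tensor_space G. F' u = F u))"
proof -
  interpret vector_space sc by fact
  let ?e = "\<lambda>z w. if w = z then 1 else (0::'k)"
  define F where "F u = (\<Sum>(a, b) | u (a, b) \<noteq> 0. sc (u (a, b)) (\<beta> (?e a) (?e b)))" for u
  have F_alt: "F u = (\<Sum>(a, b)\<in>B. sc (u (a, b)) (\<beta> (?e a) (?e b)))"
    if "finite B" "{z. u z \<noteq> 0} \<subseteq> B" for u B
  proof -
    have "{(a, b). u (a, b) \<noteq> 0} = {z. u z \<noteq> 0}" by auto
    then show ?thesis
      unfolding F_def using that
      by (intro sum.mono_neutral_left) auto
  qed
  have eA: "?e a \<in> group_algebra G" if "a \<in> carrier G" for a
    using that by (auto simp: group_algebra_def intro: finite_subset[of _ "{a}"])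
  have tens: "F (tensor r1 r2) = \<beta> r1 r2" if r1: "r1 \<in> group_algebra G" and r2: "r2 \<in> group_algebra G" for r1 r2
  proof -
    let ?A = "{a. r1 a \<noteq> 0}" and ?B = "{a. r2 a \<noteq> 0}"
    have fin: "finite ?A" "finite ?B" and sub: "?A \<subseteq> carrier G" "?B \<subseteq> carrier G"
      using r1 r2 by (auto simp: group_algebra_def)
    have "\<beta> r1 r2 = (\<Sum>a\<in>?A. sc (r1 a) (\<beta> (?e a) r2))"
      using linear_on_space_expand[OF vs l[OF r2, unfolded group_algebra_def] fin(1) sub(1)] by simp
    also have "\<dots> = (\<Sum>a\<in>?A. sc (r1 a) (\<Sum>b\<in>?B. sc (r2 b) (\<beta> (?e a) (?e b))))"
    proof (intro sum.cong refl)
      fix a assume "a \<in> ?A"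
      then have "?e a \<in> group_algebra G" using sub eA by blast
      then show "sc (r1 a) (\<beta> (?e a) r2) = sc (r1 a) (\<Sum>b\<in>?B. sc (r2 b) (\<beta> (?e a) (?e b)))"
        using linear_on_space_expand[OF vs r[unfolded group_algebra_def] fin(2) sub(2), of "?e a"]
        by (simp add: group_algebra_def)
    qed
    also have "\<dots> = (\<Sum>a\<in>?A. \<Sum>b\<in>?B. sc (r1 a * r2 b) (\<beta> (?e a) (?e b)))"
      by (simp add: scale_sum_right)
    also have "\<dots> = (\<Sum>(a, b)\<in>?A \<times> ?B. sc (tensor r1 r2 (a, b)) (\<beta> (?e a) (?e b)))"
      by (simp add: sum.cartesian_product tensor_def)
    also have "\<dots> = F (tensor r1 r2)"
      using fin by (intro F_alt[symmetric]) (auto simp: tensor_def)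
    finally show ?thesis ..
  qed
  have lin: "linear_on_space sc (tensor_space G) F"
    unfolding linear_on_space_def
  proof (intro conjI ballI allI)
    fix u v :: "'a \<times> 'a \<Rightarrow> 'k" assume "u \<in> tensor_space G" "v \<in> tensor_space G"
    then have fin: "finite ({z. u z \<noteq> 0} \<union> {z. v z \<noteq> 0})"
      by (auto simp: tensor_space_def)
    show "F (\<lambda>z. u z + v z) = F u + F v"
      unfolding F_alt[OF fin Un_upper1] F_alt[OF fin Un_upper2]
      by (subst F_alt[OF fin]) (auto simp: scale_left_distrib sum.distrib case_prod_beta)
  next
    fix c and u :: "'a \<times> 'a \<Rightarrow> 'k" assume "u \<in> tensor_space G"
    then have fin: "finite {z. u z \<noteq> 0}"
      by (auto simp: tensor_space_def)
    show "F (\<lambda>z. c * u z) = sc c (F u)"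
      unfolding F_alt[OF fin order_refl]
      by (subst F_alt[OF fin]) (auto simp: scale_sum_right case_prod_beta)
  qed
  have uniq: "F' u = F u"
    if lin': "linear_on_space sc (tensor_space G) F'"
      and tens': "\<forall>r\<in>group_algebra G. \<forall>r'\<in>group_algebra G. F' (tensor r r') = \<beta> r r'"
      and u: "u \<in> tensor_space G" for F' u
  proof -
    have fin: "finite {z. u z \<noteq> 0}" and sub: "{z. u z \<noteq> 0} \<subseteq> carrier G \<times> carrier G"
      using u by (auto simp: tensor_space_def)
    have pt: "F' (?e z) = F (?e z)" if nz: "u z \<noteq> 0" for z
    proof -
      obtain a b where z: "z = (a, b)" "a \<in> carrier G" "b \<in> carrier G"
        using sub nz by blast
      have "?e z = tensor (?e a) (?e b)"
        by (auto simp: tensor_def z fun_eq_iff)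
      then show ?thesis
        using tens tens' eA z by simp
    qed
    show ?thesis
      unfolding linear_on_space_expand[OF vs lin'[unfolded tensor_space_def] fin sub]
        linear_on_space_expand[OF vs lin[unfolded tensor_space_def] fin sub]
      using pt by (intro sum.cong) auto
  qed
  show ?thesis
    using lin tens uniq by blast
qed

section \<open>The groups \<open>U\<^sub>m\<close>, \<open>W\<close>, \<open>G~\<close>, \<open>U~\<^sub>n\<close> and \<open>N~\<close>\<close>

definition unitri_group :: "nat \<Rightarrow> 'k::field mat monoid" where
  "unitri_group m =
     \<lparr>carrier = {A \<in> carrier_mat m m. upper_triangular A \<and> (\<forall>i<m. A $$ (i, i) = 1)},
      mult = (*), one = 1\<^sub>m m\<rparr>"

type_synonym 'k W_elt = "('k mat \<Rightarrow> 'k) \<times> 'k mat"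

definition W_group :: "nat \<Rightarrow> 'k::field W_elt monoid" where
  "W_group m =
     \<lparr>carrier = group_algebra (unitri_group m) \<times> carrier (unitri_group m),
      mult = (\<lambda>(x, h) (x', h').
        (\<lambda>a. x a + left_mult (unitri_group m) h x' a, h \<otimes>\<^bsub>unitri_group m\<^esub> h')),
      one = (\<lambda>_. 0, \<one>\<^bsub>unitri_group m\<^esub>)\<rparr>"

definition G_tilde :: "nat \<Rightarrow> ('k::field W_elt \<times> 'k W_elt) monoid" where
  "G_tilde m = W_group m \<times>\<times> W_group m"

text \<open>\<open>U_tilde m\<close> is the group \<open>U~\<^sub>n\<close> for \<open>n = 2m + 1\<close>.\<close>

definition U_tilde ::
  "nat \<Rightarrow> (('k::field mat \<times> 'k mat \<Rightarrow> 'k) \<times> ('k W_elt \<times> 'k W_elt)) monoid" where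
  "U_tilde m =
     \<lparr>carrier = tensor_space (unitri_group m) \<times> carrier (G_tilde m),
      mult = (\<lambda>(u, g) (u', g').
        case (g, g') of (((x\<^sub>1, h\<^sub>1), (x\<^sub>2, h\<^sub>2)), ((x\<^sub>1', h\<^sub>1'), (x\<^sub>2', h\<^sub>2'))) \<Rightarrow>
          (\<lambda>z. u z + tensor_act (unitri_group m) h\<^sub>1 h\<^sub>2 u' z
                 + tensor x\<^sub>1 (left_mult (unitri_group m) h\<^sub>2 x\<^sub>2') z,
           g \<otimes>\<^bsub>G_tilde m\<^esub> g')),
      one = (\<lambda>_. 0, \<one>\<^bsub>G_tilde m\<^esub>)\<rparr>"

definition N_group :: "nat \<Rightarrow> 'k::field W_elt monoid" where
  "N_group m = (W_group m)\<lparr>carrier := group_algebra (unitri_group m) \<times> {\<one>\<^bsub>unitri_group m\<^esub>}\<rparr>"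

text \<open>\<open>N~\<^sub>1\<close> and \<open>N~\<^sub>2'\<close> are the same subgroup \<open>N_group m\<close> of \<open>W\<close>, placed in the first and in the
  second factor of \<open>G~\<close>.\<close>

definition N_tilde :: "nat \<Rightarrow> ('k::field W_elt \<times> 'k W_elt) monoid" where
  "N_tilde m = (G_tilde m)\<lparr>carrier := carrier (N_group m) \<times> carrier (N_group m)\<rparr>"

end

theory Submission
  imports Defs "Jordan_Normal_Form.Determinant"
begin

text \<open>Let \<open>H\<close> be the unitriangular group. A lift of \<open>\<gamma>\<close> is a cochain \<open>u\<close> on \<open>\<Gamma>\<close> with values in functions
  on \<open>S = H \<times> H\<close>, that is, a 1-cochain on the action groupoid of \<open>\<Gamma>\<close> on \<open>S\<close>, and the condition
  on \<open>u\<close> says that its coboundary is minus the cup product of two groupoid 1-cocycles \<open>x\<^sub>1\<close>, \<open>x\<^sub>2\<close>.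
  Every stabiliser of this action is \<open>\<Lambda>\<close>, so the groupoid is equivalent to a disjoint union of copies of
  \<open>\<Lambda>\<close>, one for each orbit, and the cup product is a coboundary on the groupoid as soon as it is one
  on \<open>\<Lambda>\<close> at one point of each orbit (an explicit form of Shapiro's lemma). At the point \<open>(a, b)\<close>
  this is the cup product on \<open>\<Lambda>\<close> of the \<open>a\<close>-th coordinate of \<open>x\<^sub>1\<close> and the \<open>b\<close>-th coordinate of
  \<open>x\<^sub>2\<close>. Since \<open>F\<^sub>p\<close> is a prime field, the coordinates span the degree-one cohomology of the additive
  group of the group algebra, which gives all the products in (2).\<close>

section \<open>Cup products on action groupoids\<close>

text \<open>Continuity into a discrete space becomes a condition near one point at a time. In this
  form, neighbourhoods coming from several cochains can be intersected.\<close>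

lemma continuous_map_discrete_iff_locally_constant:
  "continuous_map X (discrete_topology A) f \<longleftrightarrow>
     f \<in> topspace X \<rightarrow> A \<and>
     (\<forall>a\<in>topspace X. \<exists>U. openin X U \<and> a \<in> U \<and> (\<forall>b\<in>U. f b = f a))"
proof (intro iffI conjI ballI)
  assume f: "continuous_map X (discrete_topology A) f"
  then show fA: "f \<in> topspace X \<rightarrow> A"
    using continuous_map_funspace[OF f] by simp
  fix a assume a: "a \<in> topspace X"
  have "openin X {b \<in> topspace X. f b \<in> {f a}}"
    using a fA by (intro openin_continuous_map_preimage[OF f]) auto
  then show "\<exists>U. openin X U \<and> a \<in> U \<and> (\<forall>b\<in>U. f b = f a)"
    using a by (intro exI[of _ "{b \<in> topspace X. f b \<in> {f a}}"]) auto
next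
  assume "f \<in> topspace X \<rightarrow> A \<and>
     (\<forall>a\<in>topspace X. \<exists>U. openin X U \<and> a \<in> U \<and> (\<forall>b\<in>U. f b = f a))"
  then have fA: "f \<in> topspace X \<rightarrow> A"
    and loc: "\<And>a. a \<in> topspace X \<Longrightarrow> \<exists>U. openin X U \<and> a \<in> U \<and> (\<forall>b\<in>U. f b = f a)"
    by blast+
  show "continuous_map X (discrete_topology A) f"
    unfolding continuous_map_def
  proof (intro conjI allI impI)
    fix V assume "openin (discrete_topology A) V"
    show "openin X {a \<in> topspace X. f a \<in> V}"
    proof (subst openin_subopen, intro ballI)
      fix a assume "a \<in> {a \<in> topspace X. f a \<in> V}"
      then have a: "a \<in> topspace X" "f a \<in> V" by auto
      obtain U where U: "openin X U" "a \<in> U" "\<forall>b\<in>U. f b = f a"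
        using loc[OF a(1)] by blast
      have "U \<subseteq> {a \<in> topspace X. f a \<in> V}"
        using a(2) U(3) openin_subset[OF U(1)] by auto
      then show "\<exists>U. openin X U \<and> a \<in> U \<and> U \<subseteq> {a \<in> topspace X. f a \<in> V}"
        using U by blast
    qed
  qed (use fA in simp)
qed

text \<open>Two-sided translation is continuous, being a composite of multiplications with one
  argument fixed. It is needed for the map \<open>g\<close> to \<open>inv (c s) g (c t)\<close>,
  which moves a groupoid element to a stabiliser.\<close>

lemma topological_group_translate_open:
  assumes G: "topological_group G T" and a: "a \<in> carrier G" and b: "b \<in> carrier G"
    and U: "openin T U"
  shows "openin T {g \<in> carrier G. a \<otimes>\<^bsub>G\<^esub> g \<otimes>\<^bsub>G\<^esub> b \<in> U}"
proof -
  interpret group G using G by (simp add: topological_group_def)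
  have T: "topspace T = carrier G"
    and mul: "continuous_map (prod_topology T T) T (\<lambda>(a, b). a \<otimes>\<^bsub>G\<^esub> b)"
    using G by (auto simp: topological_group_def)
  have "continuous_map T (prod_topology T T) (\<lambda>g. (a, g))"
    using a T by (intro continuous_map_paired[THEN iffD2]) auto
  from continuous_map_compose[OF this mul]
  have l: "continuous_map T T (\<lambda>g. a \<otimes>\<^bsub>G\<^esub> g)" by (simp add: o_def)
  then have "continuous_map T (prod_topology T T) (\<lambda>g. (a \<otimes>\<^bsub>G\<^esub> g, b))"
    using b T by (intro continuous_map_paired[THEN iffD2]) auto
  from continuous_map_compose[OF this mul]
  have "continuous_map T T (\<lambda>g. a \<otimes>\<^bsub>G\<^esub> g \<otimes>\<^bsub>G\<^esub> b)" by (simp add: o_def)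
  from openin_continuous_map_preimage[OF this U] show ?thesis
    by (simp add: T)
qed

text \<open>The relation for \<open>v\<close> says that, on the stabiliser of \<open>s\<close>, the
  triple \<open>(X g s, v s g, Y g s)\<close> is a homomorphism to the Heisenberg group. Pulling
  back such homomorphisms along a retraction of the groupoid onto stabilisers of base points gives a
  cocycle whose outer coordinates differ from \<open>X\<close> and \<open>Y\<close> by coboundaries.
  A change of gauge removes the difference, and \<open>u\<close> is the resulting middle
  coordinate.\<close>

lemma cup_coboundary_on_action_groupoid:
  fixes G :: "('g, 'x) monoid_scheme" (structure) and act :: "'g \<Rightarrow> 's \<Rightarrow> 's"
    and X Y :: "'g \<Rightarrow> 's \<Rightarrow> 'k::comm_ring_1" and v :: "'s \<Rightarrow> 'g \<Rightarrow> 'k"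
  assumes G: "topological_group G T"
    and act_closed: "\<And>g s. g \<in> carrier G \<Longrightarrow> s \<in> S \<Longrightarrow> act g s \<in> S"
    and act_one: "\<And>s. s \<in> S \<Longrightarrow> act \<one>\<^bsub>G\<^esub> s = s"
    and act_mult: "\<And>g g' s. g \<in> carrier G \<Longrightarrow> g' \<in> carrier G \<Longrightarrow> s \<in> S \<Longrightarrow>
      act (g \<otimes>\<^bsub>G\<^esub> g') s = act g (act g' s)"
    and act_open: "\<And>s t. s \<in> S \<Longrightarrow> t \<in> S \<Longrightarrow> openin T {g \<in> carrier G. act g s = t}"
    and X: "\<And>g g' s. g \<in> carrier G \<Longrightarrow> g' \<in> carrier G \<Longrightarrow> s \<in> S \<Longrightarrow>
      X (g \<otimes>\<^bsub>G\<^esub> g') s = X g s + X g' (act (inv\<^bsub>G\<^esub> g) s)"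
    and Y: "\<And>g g' s. g \<in> carrier G \<Longrightarrow> g' \<in> carrier G \<Longrightarrow> s \<in> S \<Longrightarrow>
      Y (g \<otimes>\<^bsub>G\<^esub> g') s = Y g s + Y g' (act (inv\<^bsub>G\<^esub> g) s)"
    and X_cont: "\<And>s. s \<in> S \<Longrightarrow> continuous_map T (discrete_topology UNIV) (\<lambda>g. X g s)"
    and Y_cont: "\<And>s. s \<in> S \<Longrightarrow> continuous_map T (discrete_topology UNIV) (\<lambda>g. Y g s)"
    and v: "\<And>g g' s. g \<in> carrier G \<Longrightarrow> g' \<in> carrier G \<Longrightarrow> s \<in> S \<Longrightarrow> act g s = s \<Longrightarrow> act g' s = s \<Longrightarrow>
      v s (g \<otimes>\<^bsub>G\<^esub> g') = v s g + v s g' + X g s * Y g' s"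
    and v_cont: "\<And>s. s \<in> S \<Longrightarrow>
      continuous_map (subtopology T {g \<in> carrier G. act g s = s}) (discrete_topology UNIV) (v s)"
  obtains u where
    "\<And>g g' s. g \<in> carrier G \<Longrightarrow> g' \<in> carrier G \<Longrightarrow> s \<in> S \<Longrightarrow>
      u (g \<otimes>\<^bsub>G\<^esub> g') s = u g s + u g' (act (inv\<^bsub>G\<^esub> g) s) + X g s * Y g' (act (inv\<^bsub>G\<^esub> g) s)"
    and "\<And>s. s \<in> S \<Longrightarrow> continuous_map T (discrete_topology UNIV) (\<lambda>g. u g s)"
proof -
  interpret group G using G by (simp add: topological_group_def)
  have T: "topspace T = carrier G"
    using G by (auto simp: topological_group_def)
  have act_inv: "act (inv\<^bsub>G\<^esub> g) (act g s) = s" "act g (act (inv\<^bsub>G\<^esub> g) s) = s"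
    if "g \<in> carrier G" "s \<in> S" for g s
    using that act_mult[of "inv g" g s] act_mult[of g "inv g" s] act_one by auto
  define orb where "orb s = (\<lambda>g. act g s) ` carrier G" for s
  have orb_eq: "orb (act g s) = orb s" if g: "g \<in> carrier G" and s: "s \<in> S" for g s
  proof (intro equalityI subsetI)
    fix t assume "t \<in> orb (act g s)"
    then show "t \<in> orb s"
      using g s by (auto simp: orb_def act_mult[symmetric])
  next
    fix t assume "t \<in> orb s"
    then obtain k where k: "k \<in> carrier G" "t = act k s" by (auto simp: orb_def)
    then have "t = act (k \<otimes> inv g) (act g s)"
      using g s by (simp add: act_mult act_closed act_inv)
    then show "t \<in> orb (act g s)"
      using g k by (auto simp: orb_def)
  qed
  \<comment> \<open>The choice depends on the set \<open>orb s\<close> only, so all points of an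
    orbit get the same base point.\<close>
  define r where "r s = (SOME t. t \<in> orb s)" for s
  have r_act: "r (act g s) = r s" if "g \<in> carrier G" "s \<in> S" for g s
    using orb_eq[OF that] by (simp add: r_def)
  have r_orb: "r s \<in> orb s" if s: "s \<in> S" for s
  proof -
    have "s \<in> orb s" using act_one[OF s] by (force simp: orb_def)
    then show ?thesis unfolding r_def by (rule someI)
  qed
  have "\<exists>c\<in>carrier G. act c (r s) = s" if s: "s \<in> S" for s
  proof -
    obtain g where g: "g \<in> carrier G" "r s = act g s" using r_orb[OF s] by (auto simp: orb_def)
    then show ?thesis using act_inv(1)[OF _ s] by (intro bexI[of _ "inv g"]) auto
  qed
  then obtain c where c: "\<And>s. s \<in> S \<Longrightarrow> c s \<in> carrier G" "\<And>s. s \<in> S \<Longrightarrow> act (c s) (r s) = s"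
    by metis
  have r: "r s \<in> S" if "s \<in> S" for s
    using r_orb[OF that] that act_closed by (auto simp: orb_def)
  \<comment> \<open>Here \<open>g\<close> is read as an arrow from \<open>act (inv g) s\<close> to
    \<open>s\<close>. Composing it with the chosen arrows \<open>c\<close> from the base point gives
    a loop at the base point.\<close>
  define l where "l g s = inv (c s) \<otimes> g \<otimes> c (act (inv g) s)" for g s
  have l_carrier: "l g s \<in> carrier G" if "g \<in> carrier G" "s \<in> S" for g s
    using that c act_closed by (simp add: l_def)
  have l_stab: "act (l g s) (r s) = r s" if g: "g \<in> carrier G" and s: "s \<in> S" for g s
  proof -
    let ?t = "act (inv g) s"
    have t: "?t \<in> S" "r ?t = r s" using g s act_closed r_act by auto
    then have "act (c ?t) (r s) = ?t" using c(2)[of ?t] by simp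
    then have "act (l g s) (r s) = act (inv (c s)) (act g ?t)"
      using g s t c r act_closed by (simp add: l_def act_mult)
    then show ?thesis
      using g s c r act_inv(1)[of "c s" "r s"] by (simp add: act_inv)
  qed
  \<comment> \<open>This is functoriality of the retraction: the factor \<open>c ?t\<close> at the
    intermediate point cancels against its inverse.\<close>
  have l_mult: "l (g \<otimes> g') s = l g s \<otimes> l g' (act (inv g) s)"
    if g: "g \<in> carrier G" "g' \<in> carrier G" and s: "s \<in> S" for g g' s
  proof -
    let ?t = "act (inv g) s"
    have t: "?t \<in> S" using g s act_closed by auto
    have t': "act (inv (g \<otimes> g')) s = act (inv g') ?t"
      using g s by (simp add: inv_mult_group act_mult)
    have t'': "act (inv g') ?t \<in> S" using g t act_closed by auto
    have "c ?t \<otimes> (inv (c ?t) \<otimes> y) = y" if "y \<in> carrier G" for y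
      using that c t by (simp add: m_assoc[symmetric])
    then show ?thesis
      using g s t t'' c by (simp add: l_def m_assoc t')
  qed
  define kX where "kX s = X (c s) s" for s
  define kY where "kY s = Y (c s) s" for s
  \<comment> \<open>Evaluating \<open>Z\<close> on \<open>g * c ?t = c s * l g s\<close> in two ways
    shows that \<open>Z\<close> differs from its pullback along \<open>l\<close> by the coboundary
    of the 0-cochain \<open>kZ\<close>.\<close>
  have cocycle_l: "Z g s = kZ s + Z (l g s) (r s) - kZ (act (inv g) s)"
    if Z: "\<And>g g' s. g \<in> carrier G \<Longrightarrow> g' \<in> carrier G \<Longrightarrow> s \<in> S \<Longrightarrow>
        Z (g \<otimes> g') s = Z g s + Z g' (act (inv g) s)"
      and kZ: "\<And>s. kZ s = Z (c s) s" and g: "g \<in> carrier G" and s: "s \<in> S"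
    for Z :: "'g \<Rightarrow> 's \<Rightarrow> 'k" and kZ g s
  proof -
    let ?t = "act (inv g) s"
    have t: "?t \<in> S" using g s act_closed by auto
    have "g \<otimes> c ?t = c s \<otimes> l g s"
      using g s t c by (simp add: l_def m_assoc[symmetric])
    then have "Z (g \<otimes> c ?t) s = Z (c s \<otimes> l g s) s" by simp
    moreover have "Z (g \<otimes> c ?t) s = Z g s + kZ ?t"
      using g s t c by (simp add: Z kZ)
    moreover have "act (inv (c s)) s = r s"
      using act_inv(1)[of "c s" "r s"] c r s by simp
    then have "Z (c s \<otimes> l g s) s = kZ s + Z (l g s) (r s)"
      using g s c l_carrier by (simp add: Z kZ)
    ultimately show ?thesis by (simp add: algebra_simps)
  qed
  have X_l: "X g s = kX s + X (l g s) (r s) - kX (act (inv g) s)"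
    if "g \<in> carrier G" "s \<in> S" for g s
    by (rule cocycle_l) (fact X kX_def that)+
  have Y_l: "Y g s = kY s + Y (l g s) (r s) - kY (act (inv g) s)"
    if "g \<in> carrier G" "s \<in> S" for g s
    by (rule cocycle_l) (fact Y kY_def that)+
  text \<open>The middle coordinate of \<open>K s * (X l, v l, Y l) * (K t)\<inverse>\<close> in the Heisenberg group,
    where \<open>K s = (kX s, 0, kY s)\<close>, \<open>l = l g s\<close> and \<open>t = g\<inverse> s\<close>.\<close>
  define u where "u g s = v (r s) (l g s) + kX s * Y (l g s) (r s)
      + kX (act (inv g) s) * kY (act (inv g) s) - (kX s + X (l g s) (r s)) * kY (act (inv g) s)" for g s
  show ?thesis
  proof
    fix g g' s assume g: "g \<in> carrier G" "g' \<in> carrier G" and s: "s \<in> S"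
    let ?t = "act (inv g) s"
    have t: "?t \<in> S" using g s act_closed by auto
    have rt: "r ?t = r s" using r_act g s by auto
    have t': "act (inv (g \<otimes> g')) s = act (inv g') ?t"
      using g s by (simp add: inv_mult_group act_mult)
    let ?l = "l g s" and ?l' = "l g' ?t"
    have L: "?l \<in> carrier G" "?l' \<in> carrier G" "act ?l (r s) = r s" "act ?l' (r s) = r s"
      using l_carrier l_stab[of g s] l_stab[of g' ?t] g s t rt by auto
    then have "act (inv ?l) (r s) = r s" using act_inv(1)[of ?l "r s"] r[OF s] by simp
    \<comment> \<open>Loops fix the base point, so the twist in the cocycle relation disappears and
      \<open>X\<close> and \<open>Y\<close> are additive on them.\<close>
    then have XY: "X (?l \<otimes> ?l') (r s) = X ?l (r s) + X ?l' (r s)"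
      "Y (?l \<otimes> ?l') (r s) = Y ?l (r s) + Y ?l' (r s)"
      using L r[OF s] by (simp_all add: X Y)
    have vl: "v (r s) (?l \<otimes> ?l') = v (r s) ?l + v (r s) ?l' + X ?l (r s) * Y ?l' (r s)"
      using L r[OF s] by (intro v) auto
    have Xg: "X g s = kX s + X ?l (r s) - kX ?t"
      using X_l[OF g(1) s] .
    have Yg: "Y g' ?t = kY ?t + Y ?l' (r s) - kY (act (inv g') ?t)"
      using Y_l[OF g(2) t] rt by simp
    show "u (g \<otimes> g') s = u g s + u g' ?t + X g s * Y g' ?t"
      unfolding u_def t' l_mult[OF g s] rt XY vl Xg Yg by (simp add: algebra_simps)
  next
    fix s assume s: "s \<in> S"
    show "continuous_map T (discrete_topology UNIV) (\<lambda>g. u g s)"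
      unfolding continuous_map_discrete_iff_locally_constant
    proof (intro conjI ballI)
      fix g assume "g \<in> topspace T"
      then have g: "g \<in> carrier G" by (simp add: T)
      let ?t = "act (inv g) s" and ?St = "{h \<in> carrier G. act h (r s) = r s}"
      have t: "?t \<in> S" using g s act_closed by auto
      have rs: "r s \<in> S" using r s by auto
      have L: "l g s \<in> ?St" "l g s \<in> carrier G" using l_carrier l_stab g s by auto
      obtain U1 where U1: "openin T U1" "l g s \<in> U1" "\<forall>h\<in>U1. X h (r s) = X (l g s) (r s)"
        using X_cont[OF rs] L unfolding continuous_map_discrete_iff_locally_constant T by blast
      obtain U2 where U2: "openin T U2" "l g s \<in> U2" "\<forall>h\<in>U2. Y h (r s) = Y (l g s) (r s)"
        using Y_cont[OF rs] L unfolding continuous_map_discrete_iff_locally_constant T by blast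
      have "l g s \<in> topspace (subtopology T ?St)" using L T by simp
      then obtain U3 where U3: "openin (subtopology T ?St) U3" "l g s \<in> U3"
          "\<forall>h\<in>U3. v (r s) h = v (r s) (l g s)"
        using v_cont[OF rs] unfolding continuous_map_discrete_iff_locally_constant by blast
      \<comment> \<open>The stabiliser is open, so openness inside it is openness in
        \<open>T\<close>.\<close>
      have U3': "openin T U3"
        using U3(1) act_open[OF rs rs] openin_trans_full by blast
      \<comment> \<open>The second set keeps the source of the arrow equal to \<open>?t\<close>,
        which freezes \<open>c ?t\<close>, \<open>kX ?t\<close> and \<open>kY ?t\<close>. The first
        then keeps the loop \<open>l h s\<close> where \<open>X\<close>, \<open>Y\<close> and
        \<open>v\<close> are constant.\<close>
      define V where "V = {h \<in> carrier G. inv (c s) \<otimes> h \<otimes> c ?t \<in> U1 \<inter> U2 \<inter> U3}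
          \<inter> {h \<in> carrier G. act h ?t = s}"
      have "openin T V"
        unfolding V_def using U1(1) U2(1) U3' c s t act_open
        by (intro openin_Int topological_group_translate_open[OF G]) auto
      moreover have "g \<in> V"
        using g s U1 U2 U3 by (auto simp: V_def l_def act_inv)
      moreover have "u h s = u g s" if h: "h \<in> V" for h
      proof -
        have hG: "h \<in> carrier G" and "act h ?t = s" using h by (auto simp: V_def)
        then have ht: "act (inv h) s = ?t" using act_inv(1)[OF hG t] by simp
        then have "l h s \<in> U1 \<inter> U2 \<inter> U3" using h by (simp add: V_def l_def)
        then show ?thesis using U1(3) U2(3) U3(3) by (simp add: u_def ht)
      qed
      ultimately show "\<exists>U. openin T U \<and> g \<in> U \<and> (\<forall>h\<in>U. u h s = u g s)" by blast
    qed simp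
  qed
qed

section \<open>Unitriangular groups and group algebras\<close>

lemma finite_carrier_mat: "finite (carrier_mat m n :: 'a::finite mat set)"
proof (rule finite_subset)
  show "carrier_mat m n \<subseteq>
      (\<lambda>f. mat m n f) ` (PiE ({..<m} \<times> {..<n}) (\<lambda>_. UNIV :: 'a set))"
  proof
    fix A :: "'a mat" assume A: "A \<in> carrier_mat m n"
    then have "A = mat m n (restrict (($$) A) ({..<m} \<times> {..<n}))"
      by (intro eq_matI) auto
    then show "A \<in> (\<lambda>f. mat m n f) ` (PiE ({..<m} \<times> {..<n}) (\<lambda>_. UNIV))"
      by (intro image_eqI[of _ _ "restrict (($$) A) ({..<m} \<times> {..<n})"]) auto
  qed
qed (intro finite_imageI finite_PiE; simp)

lemma finite_unitri_group: "finite (carrier (unitri_group m :: 'k::{field,finite} mat monoid))"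
  by (rule finite_subset[OF _ finite_carrier_mat[of m m]]) (auto simp: unitri_group_def)

text \<open>In the sum for entry \<open>(i, j)\<close> a nonzero term needs \<open>i\<close> \<le>
  \<open>k\<close> \<le> \<open>j\<close>. No such \<open>k\<close> exists below the diagonal, and
  only \<open>k = i\<close> remains on it.\<close>

lemma unitri_group_mult_closed:
  assumes A: "A \<in> carrier (unitri_group m)" and B: "B \<in> carrier (unitri_group m)"
  shows "A * B \<in> carrier (unitri_group m)"
proof -
  have AB: "A \<in> carrier_mat m m" "B \<in> carrier_mat m m"
    and z: "\<And>i j. i < m \<Longrightarrow> j < i \<Longrightarrow> A $$ (i, j) = 0" "\<And>i j. i < m \<Longrightarrow> j < i \<Longrightarrow> B $$ (i, j) = 0"
    and d: "\<And>i. i < m \<Longrightarrow> A $$ (i, i) = 1" "\<And>i. i < m \<Longrightarrow> B $$ (i, i) = 1"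
    using A B by (auto simp: unitri_group_def upper_triangular_def)
  have ent: "(A * B) $$ (i, j) = (\<Sum>k<m. A $$ (i, k) * B $$ (k, j))" if "i < m" "j < m" for i j
    using AB that by (auto simp: scalar_prod_def lessThan_atLeast0 intro!: sum.cong)
  have "(A * B) $$ (i, j) = 0" if "i < m" "j < i" for i j
  proof -
    have "A $$ (i, k) * B $$ (k, j) = 0" if "k < m" for k
      using z \<open>i < m\<close> \<open>j < i\<close> that by (cases "k < i") auto
    then have "(\<Sum>k<m. A $$ (i, k) * B $$ (k, j)) = 0"
      by (intro sum.neutral) blast
    then show ?thesis using that ent by simp
  qed
  moreover have "(A * B) $$ (i, i) = 1" if "i < m" for i
  proof -
    have "A $$ (i, k) * B $$ (k, i) = 0" if "k < m" "k \<noteq> i" for k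
      using z \<open>i < m\<close> that by (cases "k < i") auto
    then have "(\<Sum>k<m. A $$ (i, k) * B $$ (k, i)) = (\<Sum>k<m. if k = i then 1 else 0)"
      using d that by (intro sum.cong) auto
    then show ?thesis using that ent by simp
  qed
  ultimately show ?thesis
    using AB by (auto simp: unitri_group_def)
qed

lemma group_unitri_group: "group (unitri_group m :: 'k::{field,finite} mat monoid)"
proof (rule groupI)
  let ?U = "unitri_group m :: 'k mat monoid"
  show "\<one>\<^bsub>?U\<^esub> \<in> carrier ?U" by (auto simp: unitri_group_def)
  show "A \<otimes>\<^bsub>?U\<^esub> B \<in> carrier ?U" if "A \<in> carrier ?U" "B \<in> carrier ?U" for A B
    using unitri_group_mult_closed[OF that] by (simp add: unitri_group_def)
  show "A \<otimes>\<^bsub>?U\<^esub> B \<otimes>\<^bsub>?U\<^esub> C = A \<otimes>\<^bsub>?U\<^esub> (B \<otimes>\<^bsub>?U\<^esub> C)"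
    if "A \<in> carrier ?U" "B \<in> carrier ?U" "C \<in> carrier ?U" for A B C
    using that by (auto simp: unitri_group_def)
  show "\<one>\<^bsub>?U\<^esub> \<otimes>\<^bsub>?U\<^esub> A = A" if "A \<in> carrier ?U" for A
    using that by (auto simp: unitri_group_def)
  show "\<exists>B\<in>carrier ?U. B \<otimes>\<^bsub>?U\<^esub> A = \<one>\<^bsub>?U\<^esub>" if A: "A \<in> carrier ?U" for A
  proof -
    have Am: "A \<in> carrier_mat m m" and ut: "upper_triangular A" and d: "\<And>i. i < m \<Longrightarrow> A $$ (i, i) = 1"
      using A by (auto simp: unitri_group_def)
    have "det A = prod_list (diag_mat A)" by (rule det_upper_triangular[OF ut Am])
    also have "diag_mat A = replicate m 1"
      using Am d by (intro nth_equalityI) (auto simp: diag_mat_def)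
    finally have "A \<in> Units (ring_mat TYPE('k) m ())"
      by (intro det_non_zero_imp_unit[OF Am]) simp
    then obtain C where C: "C \<in> carrier_mat m m" "A * C = 1\<^sub>m m"
      by (auto simp: Units_def ring_mat_def)
    \<comment> \<open>The matrix inverse \<open>C\<close> serves only for cancellation. On the
      finite carrier an injective right multiplication is onto, and a preimage of the identity is a
      left inverse that is already known to be unitriangular.\<close>
    have "inj_on (\<lambda>B. B * A) (carrier ?U)"
    proof (rule inj_onI)
      fix B B' assume B: "B \<in> carrier ?U" "B' \<in> carrier ?U" and eq: "B * A = B' * A"
      then have Bm: "B \<in> carrier_mat m m" "B' \<in> carrier_mat m m" by (auto simp: unitri_group_def)
      have "B * A * C = B' * A * C" by (simp add: eq)
      then show "B = B'" using Bm Am C by (simp add: assoc_mult_mat[of _ m m _ m _ m])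
    qed
    then have "(\<lambda>B. B * A) ` carrier ?U = carrier ?U"
      using A unitri_group_mult_closed by (intro endo_inj_surj finite_unitri_group) auto
    moreover have "1\<^sub>m m \<in> carrier ?U" by (auto simp: unitri_group_def)
    ultimately have "1\<^sub>m m \<in> (\<lambda>B. B * A) ` carrier ?U" by simp
    then show ?thesis by (auto simp: unitri_group_def)
  qed
qed

text \<open>Every element of the prime field is a natural multiple of 1, so additivity forces
  linearity.\<close>

lemma additive_mod_ring:
  fixes f :: "'p::prime_card mod_ring \<Rightarrow> 'p mod_ring"
  assumes add: "\<And>a b. f (a + b) = f a + f b"
  shows "f c = c * f 1"
proof -
  have 0: "f 0 = 0" using add[of 0 0] by (metis add.right_neutral add_left_cancel)
  have "f (of_nat n) = of_nat n * f 1" for n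
    by (induction n) (auto simp: 0 add algebra_simps)
  then show ?thesis
    using surj_of_nat_mod_ring[of c] by auto
qed

text \<open>Over a prime field an additive functional is linear, hence determined on the basis of
  group elements. Finiteness of the group lets the sum run over the whole carrier.\<close>

lemma additive_on_group_algebra_expand:
  fixes F :: "('a \<Rightarrow> 'p::prime_card mod_ring) \<Rightarrow> 'p mod_ring"
  assumes fin: "finite (carrier G)"
    and add: "\<And>r r'. r \<in> group_algebra G \<Longrightarrow> r' \<in> group_algebra G \<Longrightarrow> F (\<lambda>a. r a + r' a) = F r + F r'"
    and r: "r \<in> group_algebra G"
  shows "F r = (\<Sum>a\<in>carrier G. r a * F (\<lambda>b. if b = a then 1 else 0))"
proof -
  have vs: "vector_space ((*) :: 'p mod_ring \<Rightarrow> 'p mod_ring \<Rightarrow> 'p mod_ring)"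
    by unfold_locales (auto simp: algebra_simps)
  have scale: "F (\<lambda>a. c * r a) = c * F r" if "r \<in> group_algebra G" for c r
  proof -
    have mem: "(\<lambda>a. c * r a) \<in> group_algebra G" for c
      using that by (auto simp: group_algebra_def intro: finite_subset[of _ "{a. r a \<noteq> 0}"])
    have "F (\<lambda>a. (c + c') * r a) = F (\<lambda>a. c * r a) + F (\<lambda>a. c' * r a)" for c c'
      using add[OF mem mem] by (simp add: distrib_right)
    from additive_mod_ring[of "\<lambda>c. F (\<lambda>a. c * r a)", OF this, of c] show ?thesis by simp
  qed
  have "linear_on_space (*) (group_algebra G) F"
    by (auto simp: linear_on_space_def add scale)
  from linear_on_space_expand[OF vs this[unfolded group_algebra_def], of r]
  have "F r = (\<Sum>a | r a \<noteq> 0. r a * F (\<lambda>b. if b = a then 1 else 0))"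
    using r by (simp add: group_algebra_def)
  also have "\<dots> = (\<Sum>a\<in>carrier G. r a * F (\<lambda>b. if b = a then 1 else 0))"
    using r fin by (intro sum.mono_neutral_left) (auto simp: group_algebra_def)
  finally show ?thesis .
qed

lemma left_mult_one:
  assumes "group G" "r \<in> group_algebra G"
  shows "left_mult G \<one>\<^bsub>G\<^esub> r = r"
proof -
  interpret group G by fact
  show ?thesis
    using assms(2) by (auto simp: left_mult_def zero_extend_def group_algebra_def fun_eq_iff)
qed

lemma group_algebra_add:
  assumes "r \<in> group_algebra G" "r' \<in> group_algebra G"
  shows "(\<lambda>a. r a + r' a) \<in> group_algebra G"
proof -
  have "{a. r a + r' a \<noteq> 0} \<subseteq> {a. r a \<noteq> 0} \<union> {a. r' a \<noteq> 0}" by auto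
  moreover have "finite ({a. r a \<noteq> 0} \<union> {a. r' a \<noteq> 0})" "{a. r a \<noteq> 0} \<union> {a. r' a \<noteq> 0} \<subseteq> carrier G"
    using assms by (auto simp: group_algebra_def)
  ultimately show ?thesis
    unfolding group_algebra_def using finite_subset by blast
qed

section \<open>Degree-one classes and their cup products\<close>

text \<open>Since \<open>B1\<close> is trivial, every degree-one class is a singleton, and
  quantifying over classes is quantifying over cocycles.\<close>

lemma ball_carrier_H1: "(\<forall>X\<in>carrier (H1 G T). P X) \<longleftrightarrow> (\<forall>f\<in>Z1 G T. P {f})"
  by (auto simp: H1_def FactGroup_def RCOSETS_def r_coset_def B1_def cochain_group_def)

lemma pullback1_singleton: "pullback1 G T \<phi> {f} = {zero_extend (carrier G) (f \<circ> \<phi>)}"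
  by (simp add: pullback1_def r_coset_def B1_def cochain_group_def)

lemma B2_zero: "(\<lambda>_. 0) \<in> B2 G T"
  unfolding B2_def by (rule image_eqI[of _ _ "\<lambda>_. 0"]) (auto simp: d1_def zero_extend_def cochain_group_def)

lemma continuous_map_discrete_add:
  fixes f g :: "'a \<Rightarrow> 'k::plus"
  assumes "continuous_map X (discrete_topology UNIV) f" "continuous_map X (discrete_topology UNIV) g"
  shows "continuous_map X (discrete_topology UNIV) (\<lambda>a. f a + g a)"
proof -
  have "continuous_map X (prod_topology (discrete_topology UNIV) (discrete_topology UNIV)) (\<lambda>a. (f a, g a))"
    using assms by (simp add: continuous_map_paired)
  then have "continuous_map X (discrete_topology UNIV) (\<lambda>a. (f a, g a))"
    by (metis UNIV_Times_UNIV prod_topology_discrete_topology)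
  then have "continuous_map X (discrete_topology UNIV) ((\<lambda>(a, b). a + b) \<circ> (\<lambda>a. (f a, g a)))"
    by (rule continuous_map_compose) simp
  then show ?thesis by (simp add: o_def)
qed

lemma B2_add:
  assumes "w \<in> B2 G T" "w' \<in> B2 G T"
  shows "(\<lambda>z. w z + w' z) \<in> B2 G T"
proof -
  obtain f f' where f: "f \<in> carrier (C1 T)" "f' \<in> carrier (C1 T)" "w = d1 G f" "w' = d1 G f'"
    using assms by (auto simp: B2_def)
  then have "(\<lambda>a. f a + f' a) \<in> carrier (C1 T)"
    by (auto simp: cochain_group_def intro: continuous_map_discrete_add)
  moreover have "(\<lambda>z. w z + w' z) = d1 G (\<lambda>a. f a + f' a)"
    by (auto simp: f d1_def zero_extend_def fun_eq_iff)
  ultimately show ?thesis by (auto simp: B2_def)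
qed

lemma B2_uminus:
  assumes "w \<in> B2 G T"
  shows "(\<lambda>z. - w z) \<in> B2 G T"
proof -
  obtain f where f: "f \<in> carrier (C1 T)" "w = d1 G f"
    using assms by (auto simp: B2_def)
  have "continuous_map T (discrete_topology UNIV) (uminus \<circ> f)"
    using f by (intro continuous_map_compose[of _ "discrete_topology UNIV"]) (auto simp: cochain_group_def)
  then have "(\<lambda>a. - f a) \<in> carrier (C1 T)"
    using f by (auto simp: cochain_group_def o_def)
  moreover have "(\<lambda>z. - w z) = d1 G (\<lambda>a. - f a)"
    by (auto simp: f d1_def zero_extend_def fun_eq_iff)
  ultimately show ?thesis by (auto simp: B2_def)
qed

text \<open>The left side of the equation is the coset of the product cocycle and the right side is
  \<open>B2 G T\<close> itself; a coset equals the subgroup exactly when its representative lies in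
  it.\<close>

lemma cup11_singleton_eq_one_iff:
  "cup11 G T {f} {g} = \<one>\<^bsub>H2 G T\<^esub> \<longleftrightarrow> (\<lambda>(a, b). f a * g b) \<in> B2 G T"
proof -
  let ?w = "\<lambda>(a, b). f a * g b"
  have cup: "cup11 G T {f} {g} = {(\<lambda>z. w z + ?w z) |w. w \<in> B2 G T}"
    by (auto simp: cup11_def r_coset_def cochain_group_def)
  have one: "\<one>\<^bsub>H2 G T\<^esub> = B2 G T" by (simp add: H2_def FactGroup_def)
  show ?thesis
    unfolding cup one
  proof
    assume eq: "{(\<lambda>z. w z + ?w z) |w. w \<in> B2 G T} = B2 G T"
    have "(\<lambda>z. 0 + ?w z) \<in> {(\<lambda>z. w z + ?w z) |w. w \<in> B2 G T}"
      using B2_zero by fastforce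
    then show "?w \<in> B2 G T" by (simp add: eq)
  next
    assume W: "?w \<in> B2 G T"
    have "\<exists>w'\<in>B2 G T. w = (\<lambda>z. w' z + ?w z)" if w: "w \<in> B2 G T" for w
      using B2_add[OF w B2_uminus[OF W]]
      by (intro bexI[of _ "\<lambda>z. w z + - ?w z"]) auto
    then show "{(\<lambda>z. w z + ?w z) |w. w \<in> B2 G T} = B2 G T"
      using B2_add W by blast
  qed
qed

text \<open>This trades cochains vanishing off the carrier for arbitrary continuous \<open>v\<close>
  and equations on the carrier. Conversely \<open>v\<close> is extended by zero, and both sides
  vanish off the carrier because \<open>f\<close> and \<open>g\<close> do.\<close>

lemma cup_mem_B2_iff:
  fixes f g :: "'a \<Rightarrow> 'k::comm_ring_1"
  assumes T: "topspace T = carrier G" and closed: "\<And>a b. a \<in> carrier G \<Longrightarrow> b \<in> carrier G \<Longrightarrow> a \<otimes>\<^bsub>G\<^esub> b \<in> carrier G"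
    and f: "\<And>a. a \<notin> carrier G \<Longrightarrow> f a = 0" and g: "\<And>a. a \<notin> carrier G \<Longrightarrow> g a = 0"
  shows "(\<lambda>(a, b). f a * g b) \<in> B2 G T \<longleftrightarrow>
    (\<exists>v. continuous_map T (discrete_topology UNIV) v \<and>
      (\<forall>a\<in>carrier G. \<forall>b\<in>carrier G. f a * g b = v b - v (a \<otimes>\<^bsub>G\<^esub> b) + v a))"
proof
  assume "(\<lambda>(a, b). f a * g b) \<in> B2 G T"
  then obtain v where v: "v \<in> carrier (C1 T)" "(\<lambda>(a, b). f a * g b) = d1 G v"
    by (auto simp: B2_def)
  have "f a * g b = v b - v (a \<otimes>\<^bsub>G\<^esub> b) + v a" if "a \<in> carrier G" "b \<in> carrier G" for a b
    using fun_cong[OF v(2), of "(a, b)"] that by (simp add: d1_def zero_extend_def)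
  then show "\<exists>v. continuous_map T (discrete_topology UNIV) v \<and>
      (\<forall>a\<in>carrier G. \<forall>b\<in>carrier G. f a * g b = v b - v (a \<otimes>\<^bsub>G\<^esub> b) + v a)"
    using v by (auto simp: cochain_group_def)
next
  assume "\<exists>v. continuous_map T (discrete_topology UNIV) v \<and>
      (\<forall>a\<in>carrier G. \<forall>b\<in>carrier G. f a * g b = v b - v (a \<otimes>\<^bsub>G\<^esub> b) + v a)"
  then obtain v where v: "continuous_map T (discrete_topology UNIV) v"
      "\<And>a b. a \<in> carrier G \<Longrightarrow> b \<in> carrier G \<Longrightarrow> f a * g b = v b - v (a \<otimes>\<^bsub>G\<^esub> b) + v a" by blast
  let ?v = "zero_extend (carrier G) v"
  have "continuous_map T (discrete_topology UNIV) ?v"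
    using continuous_map_eq[OF v(1), of ?v] by (simp add: zero_extend_def T)
  then have "?v \<in> carrier (C1 T)"
    by (auto simp: cochain_group_def zero_extend_def T)
  moreover have "(\<lambda>(a, b). f a * g b) = d1 G ?v"
    using f g closed by (auto simp: d1_def zero_extend_def fun_eq_iff v(2))
  ultimately show "(\<lambda>(a, b). f a * g b) \<in> B2 G T" by (auto simp: B2_def)
qed

lemma N_group_mult:
  fixes r r' :: "'k::{field,finite} mat \<Rightarrow> 'k"
  assumes "r' \<in> group_algebra (unitri_group m)"
  shows "(r, \<one>\<^bsub>unitri_group m\<^esub>) \<otimes>\<^bsub>N_group m\<^esub> (r', \<one>\<^bsub>unitri_group m\<^esub>) =
    ((\<lambda>a. r a + r' a), \<one>\<^bsub>unitri_group m\<^esub>)"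
proof -
  interpret group "unitri_group m :: 'k mat monoid" by (rule group_unitri_group)
  show ?thesis
    using left_mult_one[OF group_unitri_group assms] by (simp add: N_group_def W_group_def)
qed

text \<open>Multiplication in \<open>N_group m\<close> is addition of coefficient functions, so each
  coefficient is a homomorphism. These are the classes to which (2) is applied when a lift is
  built.\<close>

lemma coordinate_mem_Z1_N_group:
  fixes a :: "'k::{field,finite} mat"
  shows "zero_extend (carrier (N_group m)) (\<lambda>n. fst n a) \<in>
    Z1 (N_group m) (discrete_topology (carrier (N_group m)))"
proof -
  let ?N = "N_group m :: 'k W_elt monoid" and ?U = "unitri_group m :: 'k mat monoid"
  let ?f = "zero_extend (carrier ?N) (\<lambda>n. fst n a)"
  have N: "carrier ?N = group_algebra ?U \<times> {\<one>\<^bsub>?U\<^esub>}"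
    by (simp add: N_group_def)
  have "d1 ?N ?f (n, n') = 0" for n n'
  proof (cases "n \<in> carrier ?N \<and> n' \<in> carrier ?N")
    case True
    then obtain r r' where n: "n = (r, \<one>\<^bsub>?U\<^esub>)" "n' = (r', \<one>\<^bsub>?U\<^esub>)"
      and r: "r \<in> group_algebra ?U" "r' \<in> group_algebra ?U"
      unfolding N by blast
    show ?thesis
      using r group_algebra_add[OF r]
      by (simp add: n d1_def zero_extend_def N_group_mult[OF r(2)] N)
  qed (auto simp: d1_def zero_extend_def)
  then show ?thesis
    by (auto simp: Z1_def cochain_group_def fun_eq_iff) (simp add: zero_extend_def)
qed

text \<open>A 1-cocycle for the trivial action is an additive functional on the group algebra, so
  over F_p it is a combination of coordinates.\<close>

lemma Z1_N_group_expand: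
  fixes r :: "'p::prime_card mod_ring mat \<Rightarrow> 'p mod_ring"
  assumes f: "f \<in> Z1 (N_group m) (discrete_topology (carrier (N_group m)))"
    and r: "r \<in> group_algebra (unitri_group m)"
  shows "f (r, \<one>\<^bsub>unitri_group m\<^esub>) =
    (\<Sum>a\<in>carrier (unitri_group m). r a * f (\<lambda>b. if b = a then 1 else 0, \<one>\<^bsub>unitri_group m\<^esub>))"
proof (rule additive_on_group_algebra_expand[OF finite_unitri_group _ r])
  fix r r' :: "'p mod_ring mat \<Rightarrow> 'p mod_ring"
  assume r: "r \<in> group_algebra (unitri_group m)" "r' \<in> group_algebra (unitri_group m)"
  let ?i = "\<one>\<^bsub>unitri_group m\<^esub> :: 'p mod_ring mat"
  have "d1 (N_group m) f ((r, ?i), (r', ?i)) = 0"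
    using f by (simp add: Z1_def)
  moreover have "(r, ?i) \<in> carrier (N_group m)" "(r', ?i) \<in> carrier (N_group m)"
    using r by (auto simp: N_group_def)
  ultimately show "f (\<lambda>a. r a + r' a, ?i) = f (r, ?i) + f (r', ?i)"
    using r by (simp add: d1_def zero_extend_def N_group_mult algebra_simps)
qed

lemma continuous_map_from_discrete_compose:
  assumes "continuous_map X (discrete_topology A) f"
  shows "continuous_map X (discrete_topology UNIV) (\<lambda>a. F (f a))"
  using continuous_map_compose[OF assms, of "discrete_topology UNIV" F] by (simp add: o_def)

section \<open>The theorem\<close>

theorem theorem6p4:
  fixes \<Gamma> :: "'g monoid" and T :: "'g topology" and m :: nat
    and \<gamma> :: "'g \<Rightarrow> ('p::prime_card mod_ring) W_elt \<times> 'p mod_ring W_elt"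
    and \<gamma>\<^sub>\<Lambda> :: "'g \<Rightarrow> 'p mod_ring W_elt \<times> 'p mod_ring W_elt"
    and \<Lambda> :: "'g monoid" and T\<^sub>\<Lambda> :: "'g topology"
  assumes "m \<ge> 1"
    and "profinite_group \<Gamma> T"
    and "\<gamma> \<in> hom \<Gamma> (G_tilde m)"
    and "continuous_map T (discrete_topology (carrier (G_tilde m))) \<gamma>"
    and "\<Lambda> = \<Gamma>\<lparr>carrier := {g \<in> carrier \<Gamma>. \<gamma> g \<in> carrier (N_tilde m)}\<rparr>"
    and "T\<^sub>\<Lambda> = subtopology T (carrier \<Lambda>)"
    and "\<gamma>\<^sub>\<Lambda> = restrict \<gamma> (carrier \<Lambda>)"
  shows
    "(\<exists>\<gamma>' \<in> hom \<Gamma> (U_tilde m).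
        continuous_map T (discrete_topology (carrier (U_tilde m))) \<gamma>' \<and>
        (\<forall>g \<in> carrier \<Gamma>. snd (\<gamma>' g) = \<gamma> g))
     \<longleftrightarrow>
     (\<forall>x \<in> carrier (H1 (N_group m) (discrete_topology (carrier (N_group m)))
               :: ('p mod_ring W_elt \<Rightarrow> 'p mod_ring) set monoid).
      \<forall>y \<in> carrier (H1 (N_group m) (discrete_topology (carrier (N_group m)))
               :: ('p mod_ring W_elt \<Rightarrow> 'p mod_ring) set monoid).
        let D = discrete_topology (carrier (N_tilde m));
            x' = pullback1 (N_tilde m) D fst x;
            y' = pullback1 (N_tilde m) D snd y
        in cup11 \<Lambda> T\<^sub>\<Lambda> (pullback1 \<Lambda> T\<^sub>\<Lambda> \<gamma>\<^sub>\<Lambda> x') (pullback1 \<Lambda> T\<^sub>\<Lambda> \<gamma>\<^sub>\<Lambda> y') = \<one>\<^bsub>H2 \<Lambda> T\<^sub>\<Lambda>\<^esub>)"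
    (is "?lift \<longleftrightarrow> ?cup")
proof -
  let ?U = "unitri_group m :: 'p mod_ring mat monoid"
  let ?H = "carrier ?U"
  let ?Z = "Z1 (N_group m) (discrete_topology (carrier (N_group m))) :: ('p mod_ring W_elt \<Rightarrow> 'p mod_ring) set"

  \<comment> \<open>Components of \<open>\<gamma>\<close> and their cocycle relations\<close>
  define x1 x2 h1 h2 where
    "x1 g = fst (fst (\<gamma> g))" and "x2 g = fst (snd (\<gamma> g))" and
    "h1 g = snd (fst (\<gamma> g))" and "h2 g = snd (snd (\<gamma> g))" for g
  have \<gamma>_eq: "\<gamma> g = ((x1 g, h1 g), (x2 g, h2 g))" for g
    by (simp add: x1_def x2_def h1_def h2_def)
  have tG: "topological_group \<Gamma> T" using assms(2) by (simp add: profinite_group_def)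
  then have grp: "group \<Gamma>" and T: "topspace T = carrier \<Gamma>" by (auto simp: topological_group_def)
  interpret \<Gamma>: group \<Gamma> by fact
  interpret U: group ?U by (rule group_unitri_group)
  have \<gamma>_closed: "\<gamma> g \<in> carrier (G_tilde m)" if "g \<in> carrier \<Gamma>" for g
    using assms(3) that by (auto simp: hom_def)
  then have x_mem: "x1 g \<in> group_algebra ?U" "x2 g \<in> group_algebra ?U"
    and h_mem: "h1 g \<in> ?H" "h2 g \<in> ?H" if "g \<in> carrier \<Gamma>" for g
    using that by (auto simp: \<gamma>_eq G_tilde_def W_group_def)
  have \<gamma>_mult: "\<gamma> (g \<otimes>\<^bsub>\<Gamma>\<^esub> g') = \<gamma> g \<otimes>\<^bsub>G_tilde m\<^esub> \<gamma> g'" if "g \<in> carrier \<Gamma>" "g' \<in> carrier \<Gamma>" for g g'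
    using assms(3) that by (auto simp: hom_def)
  have h_mult: "h1 (g \<otimes>\<^bsub>\<Gamma>\<^esub> g') = h1 g \<otimes>\<^bsub>?U\<^esub> h1 g'" "h2 (g \<otimes>\<^bsub>\<Gamma>\<^esub> g') = h2 g \<otimes>\<^bsub>?U\<^esub> h2 g'"
    and x_mult: "\<And>a. a \<in> ?H \<Longrightarrow> x1 (g \<otimes>\<^bsub>\<Gamma>\<^esub> g') a = x1 g a + x1 g' (inv\<^bsub>?U\<^esub> (h1 g) \<otimes>\<^bsub>?U\<^esub> a)"
      "\<And>a. a \<in> ?H \<Longrightarrow> x2 (g \<otimes>\<^bsub>\<Gamma>\<^esub> g') a = x2 g a + x2 g' (inv\<^bsub>?U\<^esub> (h2 g) \<otimes>\<^bsub>?U\<^esub> a)"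
    if "g \<in> carrier \<Gamma>" "g' \<in> carrier \<Gamma>" for g g'
    using \<gamma>_mult[OF that] by (simp_all add: \<gamma>_eq G_tilde_def W_group_def left_mult_def zero_extend_def)
  have "h1 \<in> hom \<Gamma> ?U" "h2 \<in> hom \<Gamma> ?U" by (auto simp: hom_def h_mem h_mult)
  then interpret h1: group_hom \<Gamma> ?U h1 + h2: group_hom \<Gamma> ?U h2
    by unfold_locales
  have \<gamma>_cont: "continuous_map T (discrete_topology UNIV) (\<lambda>g. F (\<gamma> g))"
    for F :: "_ \<Rightarrow> 'z"
    by (rule continuous_map_from_discrete_compose[OF assms(4)])
  have \<gamma>_open: "openin T {g \<in> carrier \<Gamma>. P (\<gamma> g)}" for P
    using openin_continuous_map_preimage[OF \<gamma>_cont[of P], of "{True}"] by (simp add: T)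
  \<comment> \<open>The components in the group algebra satisfy the membership conditions
    automatically, so \<open>\<Lambda>\<close> is the common kernel of \<open>h1\<close> and
    \<open>h2\<close>.\<close>
  have L: "carrier \<Lambda> = {g \<in> carrier \<Gamma>. h1 g = \<one>\<^bsub>?U\<^esub> \<and> h2 g = \<one>\<^bsub>?U\<^esub>}"
    using x_mem by (auto simp: assms(5) N_tilde_def N_group_def \<gamma>_eq)
  have \<Lambda>_mult: "g \<otimes>\<^bsub>\<Lambda>\<^esub> g' = g \<otimes>\<^bsub>\<Gamma>\<^esub> g'" for g g' by (simp add: assms(5))
  have \<Lambda>_closed: "g \<otimes>\<^bsub>\<Lambda>\<^esub> g' \<in> carrier \<Lambda>" if "g \<in> carrier \<Lambda>" "g' \<in> carrier \<Lambda>" for g g'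
    using that by (simp add: \<Lambda>_mult L h_mult)
  have T\<Lambda>: "topspace T\<^sub>\<Lambda> = carrier \<Lambda>" by (auto simp: assms(6) T L)
  have in_\<Lambda>: "\<gamma> g = ((x1 g, \<one>\<^bsub>?U\<^esub>), (x2 g, \<one>\<^bsub>?U\<^esub>))" "\<gamma> g \<in> carrier (N_tilde m)"
    "fst (\<gamma> g) \<in> carrier (N_group m)" "snd (\<gamma> g) \<in> carrier (N_group m)"
    "g \<in> carrier \<Gamma>" if "g \<in> carrier \<Lambda>" for g
    using that x_mem[of g] by (auto simp: L \<gamma>_eq N_tilde_def N_group_def)

  \<comment> \<open>Condition (2) as an equation between cochains on
    \<open>\<Lambda>\<close>\<close>
  have cup_iff: "?cup \<longleftrightarrow> (\<forall>f\<in>?Z. \<forall>f'\<in>?Z. \<exists>v. continuous_map T\<^sub>\<Lambda> (discrete_topology UNIV) v \<and>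
      (\<forall>g\<in>carrier \<Lambda>. \<forall>g'\<in>carrier \<Lambda>.
        f (fst (\<gamma> g)) * f' (snd (\<gamma> g')) = v g' - v (g \<otimes>\<^bsub>\<Gamma>\<^esub> g') + v g))"
  proof -
    \<comment> \<open>The two successive pullbacks each extend by zero. On \<open>\<Lambda>\<close>
      neither extension is visible, since \<open>\<gamma>\<close> takes values in
      \<open>N_tilde m\<close> there.\<close>
    let ?p = "\<lambda>f. zero_extend (carrier \<Lambda>) (zero_extend (carrier (N_tilde m)) f \<circ> \<gamma>\<^sub>\<Lambda>) :: 'g \<Rightarrow> 'p mod_ring"
    have p: "?p f g = f (\<gamma> g)" if "g \<in> carrier \<Lambda>" for f g
      using that in_\<Lambda>(2)[OF that] by (simp add: zero_extend_def assms(7))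
    have p0: "?p f g = 0" if "g \<notin> carrier \<Lambda>" for f g
      using that by (simp add: zero_extend_def)
    have "?cup \<longleftrightarrow> (\<forall>f\<in>?Z. \<forall>f'\<in>?Z. (\<lambda>(g, g'). ?p (f \<circ> fst) g * ?p (f' \<circ> snd) g') \<in> B2 \<Lambda> T\<^sub>\<Lambda>)"
      unfolding ball_carrier_H1 Let_def pullback1_singleton cup11_singleton_eq_one_iff ..
    also have "\<dots> \<longleftrightarrow> (\<forall>f\<in>?Z. \<forall>f'\<in>?Z. \<exists>v. continuous_map T\<^sub>\<Lambda> (discrete_topology UNIV) v \<and>
      (\<forall>g\<in>carrier \<Lambda>. \<forall>g'\<in>carrier \<Lambda>.
        ?p (f \<circ> fst) g * ?p (f' \<circ> snd) g' = v g' - v (g \<otimes>\<^bsub>\<Lambda>\<^esub> g') + v g))"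
      by (intro ball_cong refl cup_mem_B2_iff T\<Lambda> \<Lambda>_closed p0)
    finally show ?thesis
      by (simp add: p \<Lambda>_mult cong: ball_cong)
  qed
  show ?thesis
    unfolding cup_iff
  proof (intro iffI ballI)

    \<comment> \<open>A lift makes the cup products vanish\<close>
    fix f f' assume lift: ?lift and f: "f \<in> ?Z" "f' \<in> ?Z"
    from lift obtain \<gamma>' where \<gamma>': "\<gamma>' \<in> hom \<Gamma> (U_tilde m)"
        "continuous_map T (discrete_topology (carrier (U_tilde m))) \<gamma>'"
        "\<And>g. g \<in> carrier \<Gamma> \<Longrightarrow> snd (\<gamma>' g) = \<gamma> g" by blast
    define u where "u g = fst (\<gamma>' g)" for g
    have \<gamma>'_eq: "\<gamma>' g = (u g, ((x1 g, \<one>\<^bsub>?U\<^esub>), (x2 g, \<one>\<^bsub>?U\<^esub>)))" if "g \<in> carrier \<Lambda>" for g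
      using \<gamma>'(3)[of g] in_\<Lambda>[OF that] by (metis u_def prod.collapse)
    \<comment> \<open>Both matrix components are trivial on \<open>\<Lambda>\<close>, so the actions
      in the product of \<open>U_tilde m\<close> drop out and each coordinate of \<open>u\<close> is
      an ordinary cochain.\<close>
    have u_mult: "u (g \<otimes>\<^bsub>\<Gamma>\<^esub> g') (a, b) = u g (a, b) + u g' (a, b) + x1 g a * x2 g' b"
      if g: "g \<in> carrier \<Lambda>" "g' \<in> carrier \<Lambda>" and ab: "a \<in> ?H" "b \<in> ?H" for g g' a b
    proof -
      have "\<gamma>' (g \<otimes>\<^bsub>\<Gamma>\<^esub> g') = \<gamma>' g \<otimes>\<^bsub>U_tilde m\<^esub> \<gamma>' g'"
        using \<gamma>'(1) in_\<Lambda>(5)[OF g(1)] in_\<Lambda>(5)[OF g(2)] by (auto simp: hom_def)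
      moreover have "u (g \<otimes>\<^bsub>\<Gamma>\<^esub> g') = fst (\<gamma>' (g \<otimes>\<^bsub>\<Gamma>\<^esub> g'))" by (simp add: u_def)
      ultimately show ?thesis
        using ab by (simp add: \<gamma>'_eq[OF g(1)] \<gamma>'_eq[OF g(2)] U_tilde_def tensor_act_def
            left_mult_def tensor_def zero_extend_def)
    qed
    let ?e = "\<lambda>a. (\<lambda>b. if b = a then 1 else 0, \<one>\<^bsub>?U\<^esub>)"
    \<comment> \<open>This is the functional \<open>f\<close> \<otimes> \<open>f'\<close> written in
      the basis of the tensor product. The cochain used is \<open>- q (u g)\<close>: the product of
      \<open>f\<close> and \<open>f'\<close> is \<open>q\<close> of the defect
      \<open>u (g g') - u g - u g'\<close>, the negative of a coboundary.\<close>
    define q where "q z = (\<Sum>a\<in>?H. \<Sum>b\<in>?H. f (?e a) * f' (?e b) * z (a, b))" for z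
    have "continuous_map T (discrete_topology UNIV) (\<lambda>g. - q (fst (\<gamma>' g)))"
      by (rule continuous_map_from_discrete_compose[OF \<gamma>'(2)])
    then have "continuous_map T\<^sub>\<Lambda> (discrete_topology UNIV) (\<lambda>g. - q (u g))"
      unfolding assms(6) u_def by (rule continuous_map_from_subtopology)
    moreover have "f (fst (\<gamma> g)) * f' (snd (\<gamma> g')) = - q (u g') - - q (u (g \<otimes>\<^bsub>\<Gamma>\<^esub> g')) + - q (u g)"
      if g: "g \<in> carrier \<Lambda>" "g' \<in> carrier \<Lambda>" for g g'
    proof -
      have "f (fst (\<gamma> g)) * f' (snd (\<gamma> g')) = f (x1 g, \<one>\<^bsub>?U\<^esub>) * f' (x2 g', \<one>\<^bsub>?U\<^esub>)"
        by (simp add: in_\<Lambda>(1)[OF g(1)] in_\<Lambda>(1)[OF g(2)])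
      also have "\<dots> = (\<Sum>a\<in>?H. x1 g a * f (?e a)) * (\<Sum>b\<in>?H. x2 g' b * f' (?e b))"
        using Z1_N_group_expand[OF f(1) x_mem(1)[OF in_\<Lambda>(5)[OF g(1)]]]
          Z1_N_group_expand[OF f(2) x_mem(2)[OF in_\<Lambda>(5)[OF g(2)]]] by simp
      also have "\<dots> = (\<Sum>a\<in>?H. \<Sum>b\<in>?H. f (?e a) * f' (?e b) * (x1 g a * x2 g' b))"
        unfolding sum_product by (intro sum.cong refl) (simp add: mult_ac)
      also have "\<dots> = (\<Sum>a\<in>?H. \<Sum>b\<in>?H. f (?e a) * f' (?e b) *
          (u (g \<otimes>\<^bsub>\<Gamma>\<^esub> g') (a, b) - u g (a, b) - u g' (a, b)))"
        using g by (intro sum.cong refl) (simp add: u_mult)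
      also have "\<dots> = q (u (g \<otimes>\<^bsub>\<Gamma>\<^esub> g')) - q (u g) - q (u g')"
        unfolding q_def by (simp add: right_diff_distrib sum_subtractf)
      finally show ?thesis by simp
    qed
    ultimately show "\<exists>v. continuous_map T\<^sub>\<Lambda> (discrete_topology UNIV) v \<and>
      (\<forall>g\<in>carrier \<Lambda>. \<forall>g'\<in>carrier \<Lambda>.
        f (fst (\<gamma> g)) * f' (snd (\<gamma> g')) = v g' - v (g \<otimes>\<^bsub>\<Gamma>\<^esub> g') + v g)"
      by (intro exI[of _ "\<lambda>g. - q (u g)"]) blast
  next

    \<comment> \<open>Vanishing cup products give a lift\<close>
    assume cup: "\<forall>f\<in>?Z. \<forall>f'\<in>?Z. \<exists>v. continuous_map T\<^sub>\<Lambda> (discrete_topology UNIV) v \<and>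
      (\<forall>g\<in>carrier \<Lambda>. \<forall>g'\<in>carrier \<Lambda>.
        f (fst (\<gamma> g)) * f' (snd (\<gamma> g')) = v g' - v (g \<otimes>\<^bsub>\<Gamma>\<^esub> g') + v g)"
    let ?c = "\<lambda>a. zero_extend (carrier (N_group m)) (\<lambda>n. fst n a) :: 'p mod_ring W_elt \<Rightarrow> 'p mod_ring"
    \<comment> \<open>The coordinates at all pairs of matrices are cocycles, so \<open>s\<close> may
      range over the whole type and \<open>v\<close> can be chosen without side conditions.\<close>
    have "\<forall>s. \<exists>v. continuous_map T\<^sub>\<Lambda> (discrete_topology UNIV) v \<and>
      (\<forall>g\<in>carrier \<Lambda>. \<forall>g'\<in>carrier \<Lambda>.
        x1 g (fst s) * x2 g' (snd s) = v g' - v (g \<otimes>\<^bsub>\<Gamma>\<^esub> g') + v g)"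
    proof
      fix s :: "'p mod_ring mat \<times> 'p mod_ring mat"
      have "?c (fst s) (fst (\<gamma> g)) = x1 g (fst s)" "?c (snd s) (snd (\<gamma> g)) = x2 g (snd s)"
        if "g \<in> carrier \<Lambda>" for g
        using in_\<Lambda>(3,4)[OF that] by (simp_all add: zero_extend_def x1_def x2_def)
      then show "\<exists>v. continuous_map T\<^sub>\<Lambda> (discrete_topology UNIV) v \<and>
        (\<forall>g\<in>carrier \<Lambda>. \<forall>g'\<in>carrier \<Lambda>.
          x1 g (fst s) * x2 g' (snd s) = v g' - v (g \<otimes>\<^bsub>\<Gamma>\<^esub> g') + v g)"
        using cup[rule_format, of "?c (fst s)" "?c (snd s)"]
        by (simp add: coordinate_mem_Z1_N_group cong: ball_cong)
    qed
    then obtain v where v: "\<And>s. continuous_map T\<^sub>\<Lambda> (discrete_topology UNIV) (v s)"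
      "\<And>s g g'. g \<in> carrier \<Lambda> \<Longrightarrow> g' \<in> carrier \<Lambda> \<Longrightarrow>
        x1 g (fst s) * x2 g' (snd s) = v s g' - v s (g \<otimes>\<^bsub>\<Gamma>\<^esub> g') + v s g"
      by metis
    \<comment> \<open>\<open>\<Gamma>\<close> acts through left translations, which are free; this
      is why every stabiliser is \<open>\<Lambda>\<close>.\<close>
    define act where "act g s = (h1 g \<otimes>\<^bsub>?U\<^esub> fst s, h2 g \<otimes>\<^bsub>?U\<^esub> snd s)" for g s
    have stab: "act g s = s \<longleftrightarrow> g \<in> carrier \<Lambda>" if "g \<in> carrier \<Gamma>" "s \<in> ?H \<times> ?H" for g s
      using that h_mem[of g] by (auto simp: act_def L)
    have stab_eq: "{g \<in> carrier \<Gamma>. act g s = s} = carrier \<Lambda>" if "s \<in> ?H \<times> ?H" for s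
      using stab that in_\<Lambda>(5) by blast
    have act_inv: "act (inv\<^bsub>\<Gamma>\<^esub> g) (a, b) = (inv\<^bsub>?U\<^esub> (h1 g) \<otimes>\<^bsub>?U\<^esub> a, inv\<^bsub>?U\<^esub> (h2 g) \<otimes>\<^bsub>?U\<^esub> b)"
      if "g \<in> carrier \<Gamma>" for g a b
      using that by (simp add: act_def)
    \<comment> \<open>The groupoid relation has the product with a plus sign, whereas
      \<open>v\<close> has the product as its coboundary. Hence \<open>- v s\<close> is supplied as
      the local solution.\<close>
    obtain u where u: "\<And>g g' s. g \<in> carrier \<Gamma> \<Longrightarrow> g' \<in> carrier \<Gamma> \<Longrightarrow> s \<in> ?H \<times> ?H \<Longrightarrow>
        u (g \<otimes>\<^bsub>\<Gamma>\<^esub> g') s = u g s + u g' (act (inv\<^bsub>\<Gamma>\<^esub> g) s) + x1 g (fst s) * x2 g' (snd (act (inv\<^bsub>\<Gamma>\<^esub> g) s))"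
      and u_cont: "\<And>s. s \<in> ?H \<times> ?H \<Longrightarrow> continuous_map T (discrete_topology UNIV) (\<lambda>g. u g s)"
    proof (rule cup_coboundary_on_action_groupoid[OF tG, of "?H \<times> ?H" act
          "\<lambda>g s. x1 g (fst s)" "\<lambda>g s. x2 g (snd s)" "\<lambda>s g. - v s g"])
      show "openin T {g \<in> carrier \<Gamma>. act g s = t}" for s t
        using \<gamma>_open[of "\<lambda>w. (snd (fst w) \<otimes>\<^bsub>?U\<^esub> fst s, snd (snd w) \<otimes>\<^bsub>?U\<^esub> snd s) = t"]
        by (simp add: act_def h1_def h2_def)
      show "continuous_map T (discrete_topology UNIV) (\<lambda>g. x1 g (fst s))"
        "continuous_map T (discrete_topology UNIV) (\<lambda>g. x2 g (snd s))" for s :: "_ \<times> _"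
        unfolding x1_def x2_def by (rule \<gamma>_cont)+
      show "continuous_map (subtopology T {g \<in> carrier \<Gamma>. act g s = s}) (discrete_topology UNIV)
          (\<lambda>g. - v s g)" if "s \<in> ?H \<times> ?H" for s
        using continuous_map_from_discrete_compose[OF v(1)[of s], of uminus]
        by (simp add: stab_eq[OF that] assms(6))
      show "- v s (g \<otimes>\<^bsub>\<Gamma>\<^esub> g') = - v s g + - v s g' + x1 g (fst s) * x2 g' (snd s)"
        if "g \<in> carrier \<Gamma>" "g' \<in> carrier \<Gamma>" "s \<in> ?H \<times> ?H" "act g s = s" "act g' s = s" for g g' s
        using v(2)[of g g' s] that by (simp add: stab)
    qed (auto simp: act_def h_mem h_mult x_mult U.m_assoc)
    \<comment> \<open>Nothing is known about \<open>u g\<close> off the basis pairs, so it is cut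
      off there to give an element of the tensor space.\<close>
    define \<gamma>' where "\<gamma>' g = (zero_extend (?H \<times> ?H) (u g), \<gamma> g)" for g
    have ts: "zero_extend (?H \<times> ?H) w \<in> tensor_space ?U" for w :: "_ \<Rightarrow> 'p mod_ring"
      unfolding tensor_space_def zero_extend_def
      by (auto intro: finite_subset[of _ "?H \<times> ?H"] simp: finite_unitri_group)
    have "\<gamma>' \<in> hom \<Gamma> (U_tilde m)"
    proof (rule homI)
      fix g g' assume g: "g \<in> carrier \<Gamma>" "g' \<in> carrier \<Gamma>"
      have "zero_extend (?H \<times> ?H) (u (g \<otimes>\<^bsub>\<Gamma>\<^esub> g')) z =
          zero_extend (?H \<times> ?H) (u g) z
          + tensor_act ?U (h1 g) (h2 g) (zero_extend (?H \<times> ?H) (u g')) z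
          + tensor (x1 g) (left_mult ?U (h2 g) (x2 g')) z" for z
      proof (cases z)
        case (Pair a b)
        \<comment> \<open>Off the basis the tensor term must vanish too. For the first index this
          comes from the support of \<open>x1 g\<close>, for the second from the zero extension in
          \<open>left_mult\<close>.\<close>
        have "x1 g a = 0" if "a \<notin> ?H"
          using x_mem(1)[OF g(1)] that by (auto simp: group_algebra_def)
        then show ?thesis
          using u[OF g, of z] h_mem[OF g(1)]
          by (auto simp: Pair zero_extend_def tensor_act_def tensor_def left_mult_def act_inv[OF g(1)])
      qed
      then show "\<gamma>' (g \<otimes>\<^bsub>\<Gamma>\<^esub> g') = \<gamma>' g \<otimes>\<^bsub>U_tilde m\<^esub> \<gamma>' g'"
        using \<gamma>_mult[OF g] by (simp add: \<gamma>'_def U_tilde_def \<gamma>_eq fun_eq_iff)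
    qed (simp add: \<gamma>'_def U_tilde_def ts \<gamma>_closed)
    moreover have "continuous_map T (discrete_topology (carrier (U_tilde m))) \<gamma>'"
      unfolding continuous_map_discrete_iff_locally_constant
    proof (intro conjI ballI)
      show "\<gamma>' \<in> topspace T \<rightarrow> carrier (U_tilde m)"
        by (auto simp: T \<gamma>'_def U_tilde_def ts \<gamma>_closed)
      fix g assume g: "g \<in> topspace T"
      have "\<forall>s. \<exists>B. s \<in> ?H \<times> ?H \<longrightarrow> openin T B \<and> g \<in> B \<and> (\<forall>g'\<in>B. u g' s = u g s)"
        using u_cont g unfolding continuous_map_discrete_iff_locally_constant by meson
      then obtain B where B: "\<And>s. s \<in> ?H \<times> ?H \<Longrightarrow> openin T (B s)"
          "\<And>s. s \<in> ?H \<times> ?H \<Longrightarrow> g \<in> B s"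
          "\<And>s g'. s \<in> ?H \<times> ?H \<Longrightarrow> g' \<in> B s \<Longrightarrow> u g' s = u g s"
        by metis
      \<comment> \<open>The value of \<open>\<gamma>'\<close> is determined by
        \<open>\<gamma>\<close> and finitely many coordinates of \<open>u\<close>, so a finite
        intersection of neighbourhoods suffices.\<close>
      define V where "V = ((\<Inter>s\<in>?H \<times> ?H. B s) \<inter> topspace T) \<inter> {g' \<in> carrier \<Gamma>. \<gamma> g' = \<gamma> g}"
      have "openin T V"
        unfolding V_def by (intro openin_Int openin_INT \<gamma>_open B(1)) (auto simp: finite_unitri_group)
      moreover have "g \<in> V" using g B(2) by (auto simp: V_def T)
      moreover have "\<gamma>' g' = \<gamma>' g" if "g' \<in> V" for g'
        using that B(3) by (auto simp: V_def \<gamma>'_def zero_extend_def fun_eq_iff)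
      ultimately show "\<exists>B. openin T B \<and> g \<in> B \<and> (\<forall>g'\<in>B. \<gamma>' g' = \<gamma>' g)" by blast
    qed
    ultimately show ?lift
      by (intro bexI[of _ \<gamma>']) (auto simp: \<gamma>'_def)
  qed
qed

end
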